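(* Let $G$ be a finite simple graph with at least two vertices and without isolated vertex. Then $\mathcal{M}_G$ defines a map on all finite simple graphs which counts occurrences of $G$ as a subgraph: for every finite simple graph $H$, the value $\mathcal{M}_G(H)$ is well defined (independent of the labeling of $H$ chosen to compute it) and equals the number of subgraphs of $H$ (not necessarily induced) that are isomorphic to $G$.
   Context: Graphs are finite, undirected, without loops or multiple edges. Let $x_{ij}$, for integers $0<i<j$, be commuting variables; infinite formal sums of monomials in them are allowed. Action: for $\sigma \in \mathfrak{S}_n$ and $1\le i<j\le n$, $\sigma\cdot(i,j) := (\min(\sigma(i),\sigma(j)),\max(\sigma(i),\sigma(j)))$. Definition of $\mathcal{M}_G$: let $G$ be a graph on $n\ge 2$ vertices without isolated vertex. Choose any labeling of the vertices of $G$ by $1,\dots,n$ and let $a_{ij}\in\{0,1\}$ ($1\le i<j\le n$) be $1$ if and only if $i$ and $j$ are adjacent. Let $R\subset\mathfrak{S}_n$ be a set of permutations such that the families $(a_{\sigma\cdot(i,j)})_{1\le i<j\le n}$, $\sigma\in R$, are pairwise distinct and exhaust all the families obtained for $\sigma\in\mathfrak{S}_n$. Then $$\mathcal{M}_G := \sum_{0<r_1<\dots<r_n}\ \sum_{\sigma\in R}\ \prod_{1\le i<j\le n} x_{r_i r_j}^{a_{\sigma\cdot(i,j)}} .$$ Evaluation: for a finite graph $H$ on $N$ vertices, choose a labeling of its vertices by $1,\dots,N$; put $b_{ij}=1$ if $i<j\le N$ and $i,j$ are adjacent in $H$, and $b_{ij}=0$ for all other pairs $i<j$ (in particular whenever $j>N$).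 Then $\mathcal{M}_G(H)$ is obtained by substituting $x_{ij}=b_{ij}$ in $\mathcal{M}_G$; only finitely many monomials give a nonzero value. A subgraph of $H$ isomorphic to $G$ is a pair (vertex subset, edge subset) of $H$ forming a graph isomorphic to $G$; thus occurrences are counted up to automorphisms of $G$ (e.g. $\mathcal{M}_G(G)=1$). *)

theory Defs
  imports
    "HOL-Library.FuncSet"
    "HOL-Library.Poly_Mapping"
    "HOL-Combinatorics.Permutations"
begin

subsection \<open>Finite simple graphs and subgraph occurrences\<close>

type_synonym 'v graph = "'v set \<times> 'v set set"

abbreviation verts :: "'v graph \<Rightarrow> 'v set" where "verts \<equiv> fst"
abbreviation edges :: "'v graph \<Rightarrow> 'v set set" where "edges \<equiv> snd"

definition simple_graph :: "'v graph \<Rightarrow> bool" where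
  "simple_graph G \<longleftrightarrow> finite (verts G) \<and> (\<forall>e\<in>edges G. e \<subseteq> verts G \<and> card e = 2)"

definition no_isolated_vertex :: "'v graph \<Rightarrow> bool" where
  "no_isolated_vertex G \<longleftrightarrow> (\<forall>v\<in>verts G. \<exists>w\<in>verts G. {v, w} \<in> edges G)"

definition graph_iso :: "'v graph \<Rightarrow> 'w graph \<Rightarrow> bool" where
  "graph_iso G H \<longleftrightarrow> (\<exists>f. bij_betw f (verts G) (verts H) \<and>
     (\<forall>u\<in>verts G. \<forall>v\<in>verts G. {u, v} \<in> edges G \<longleftrightarrow> {f u, f v} \<in> edges H))"

definition copies :: "'v graph \<Rightarrow> 'w graph \<Rightarrow> 'w graph set" where
  "copies G H = {K. simple_graph K \<and> verts K \<subseteq> verts H \<and> edges K \<subseteq> edges H \<and> graph_iso G K}"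

lemma finite_copies:
  assumes "simple_graph H"
  shows "finite (copies G H)"
proof (rule finite_subset)
  show "copies G H \<subseteq> Pow (verts H) \<times> Pow (edges H)"
    by (auto simp: copies_def)
  have "edges H \<subseteq> Pow (verts H)"
    using assms by (auto simp: simple_graph_def)
  then show "finite (Pow (verts H) \<times> Pow (edges H))"
    using assms by (auto simp: simple_graph_def intro: finite_subset)
qed


subsection \<open>Labelings and adjacency families\<close>

text \<open>A labeling is given in the direction label to vertex; only its values on
  \<open>{1..card (verts G)}\<close> matter.\<close>

definition labeling :: "'v graph \<Rightarrow> (nat \<Rightarrow> 'v) \<Rightarrow> bool" where
  "labeling G l \<longleftrightarrow> bij_betw l {1..card (verts G)} (verts G)"

lemma labeling_exists:
  assumes "simple_graph G"
  shows "\<exists>l. labeling G l"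
  using ex_bij_betw_nat_finite_1[of "verts G"] assms
  by (auto simp: labeling_def simple_graph_def)

text \<open>The 0/1 family of a labeled graph, extended by 0 to all pairs. It is used both for the
  exponents \<open>a\<^sub>i\<^sub>j\<close> (in \<open>nat\<close>) and for the substituted values \<open>b\<^sub>i\<^sub>j\<close> (in \<open>int\<close>).\<close>

definition adj :: "'v graph \<Rightarrow> (nat \<Rightarrow> 'v) \<Rightarrow> nat \<times> nat \<Rightarrow> 'c::zero_neq_one" where
  "adj G l = (\<lambda>(i, j). of_bool (0 < i \<and> i < j \<and> j \<le> card (verts G) \<and> {l i, l j} \<in> edges G))"

definition index_pairs :: "nat \<Rightarrow> (nat \<times> nat) set" where
  "index_pairs n = {(i, j). 1 \<le> i \<and> i < j \<and> j \<le> n}"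

definition perm_act :: "(nat \<Rightarrow> nat) \<Rightarrow> nat \<times> nat \<Rightarrow> nat \<times> nat" where
  "perm_act \<sigma> = (\<lambda>(i, j). (min (\<sigma> i) (\<sigma> j), max (\<sigma> i) (\<sigma> j)))"

definition permuted_family :: "nat \<Rightarrow> (nat \<times> nat \<Rightarrow> nat) \<Rightarrow> (nat \<Rightarrow> nat) \<Rightarrow> nat \<times> nat \<Rightarrow> nat" where
  "permuted_family n a \<sigma> = (\<lambda>p\<in>index_pairs n. a (perm_act \<sigma> p))"

definition representatives :: "nat \<Rightarrow> (nat \<times> nat \<Rightarrow> nat) \<Rightarrow> (nat \<Rightarrow> nat) set \<Rightarrow> bool" where
  "representatives n a R \<longleftrightarrow>
     R \<subseteq> {\<sigma>. \<sigma> permutes {1..n}} \<and>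
     inj_on (permuted_family n a) R \<and>
     permuted_family n a ` R = permuted_family n a ` {\<sigma>. \<sigma> permutes {1..n}}"

lemma representatives_exist: "\<exists>R. representatives n a R"
proof -
  let ?f = "permuted_family n a" and ?S = "{\<sigma>. \<sigma> permutes {1..n}}"
  obtain R where "R \<subseteq> ?S" "inj_on ?f R" "?f ` ?S = ?f ` R"
    using iffD1[OF subset_image_inj[of "?f ` ?S" ?f ?S] subset_refl] by blast
  then have "representatives n a R"
    unfolding representatives_def by (intro conjI) (assumption | erule sym)+
  then show ?thesis ..
qed


subsection \<open>Formal sums of monomials\<close>

text \<open>A monomial in the variables \<open>x\<^sub>i\<^sub>j\<close> is its exponent map, so that products of monomials are
  sums of exponent maps; a formal series is its coefficient function.\<close>

type_synonym monomial = "(nat \<times> nat) \<Rightarrow>\<^sub>0 nat"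
type_synonym series = "monomial \<Rightarrow> int"

text \<open>The formal sum of a family of monomials. It is meaningful only if every monomial occurs
  finitely often, since \<^const>\<open>card\<close> is 0 on infinite sets.\<close>

definition formal_summable :: "'i set \<Rightarrow> ('i \<Rightarrow> monomial) \<Rightarrow> bool" where
  "formal_summable I f \<longleftrightarrow> (\<forall>m. finite {i\<in>I. f i = m})"

definition formal_sum :: "'i set \<Rightarrow> ('i \<Rightarrow> monomial) \<Rightarrow> series" where
  "formal_sum I f = (\<lambda>m. int (card {i\<in>I. f i = m}))"

definition monomial_value :: "(nat \<times> nat \<Rightarrow> int) \<Rightarrow> monomial \<Rightarrow> int" where
  "monomial_value x m = (\<Prod>p\<in>Poly_Mapping.keys m. x p ^ Poly_Mapping.lookup m p)"

text \<open>Substitution is meaningful only if finitely many terms are nonzero (otherwise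
  \<^const>\<open>Sum_any\<close> returns 0).\<close>

definition substitutable :: "series \<Rightarrow> (nat \<times> nat \<Rightarrow> int) \<Rightarrow> bool" where
  "substitutable F x \<longleftrightarrow> finite {m. F m * monomial_value x m \<noteq> 0}"

definition substitute :: "series \<Rightarrow> (nat \<times> nat \<Rightarrow> int) \<Rightarrow> int" where
  "substitute F x = (\<Sum>m. F m * monomial_value x m)"


subsection \<open>The series \<open>M\<^sub>G\<close>\<close>

definition increasing_seqs :: "nat \<Rightarrow> (nat \<Rightarrow> nat) set" where
  "increasing_seqs n = {r \<in> {1..n} \<rightarrow>\<^sub>E {0<..}. strict_mono_on {1..n} r}"

definition M_index :: "'v graph \<Rightarrow> (nat \<Rightarrow> nat) set \<Rightarrow> ((nat \<Rightarrow> nat) \<times> (nat \<Rightarrow> nat)) set" where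
  "M_index G R = increasing_seqs (card (verts G)) \<times> R"

definition M_term :: "'v graph \<Rightarrow> (nat \<Rightarrow> 'v) \<Rightarrow> (nat \<Rightarrow> nat) \<times> (nat \<Rightarrow> nat) \<Rightarrow> monomial" where
  "M_term G l = (\<lambda>(r, \<sigma>). \<Sum>(i, j)\<in>index_pairs (card (verts G)).
     Poly_Mapping.single (r i, r j) (adj G l (perm_act \<sigma> (i, j))))"

definition M :: "'v graph \<Rightarrow> (nat \<Rightarrow> 'v) \<Rightarrow> (nat \<Rightarrow> nat) set \<Rightarrow> series" where
  "M G l R = formal_sum (M_index G R) (M_term G l)"

end

theory Submission
  imports Defs "HOL-Library.Infinite_Set"
begin

text \<open>Since \<open>G\<close> has no isolated vertex, the variables occurring in the monomial of \<open>(r, \<sigma>)\<close>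
  determine the set \<open>{r\<^sub>1, \<dots>, r\<^sub>n}\<close>, hence \<open>r\<close>, hence the permuted family, hence \<open>\<sigma>\<close>. All
  coefficients of \<open>M\<^sub>G\<close> are therefore 0 or 1, and \<open>M\<^sub>G(H)\<close> counts the pairs \<open>(r, \<sigma>)\<close> whose
  variables all correspond to edges of \<open>H\<close>. Reading these variables as edges of \<open>H\<close> is a
  bijection from such pairs onto the copies of \<open>G\<close> in \<open>H\<close>.\<close>

section \<open>Increasing sequences and finite sets of positive integers\<close>

text \<open>A strictly increasing sequence lists its range as a sorted list without repetition, and
  such a list is determined by its set. Outside \<open>{1..n}\<close> both functions are
  \<open>undefined\<close>, so agreement on \<open>{1..n}\<close> suffices.\<close>

lemma increasing_seqs_inj:
  assumes "r \<in> increasing_seqs n" "s \<in> increasing_seqs n" "r ` {1..n} = s ` {1..n}"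
  shows "r = s"
proof -
  have *: "sorted (map t [1..<Suc n]) \<and> distinct (map t [1..<Suc n])"
    if "t \<in> increasing_seqs n" for t
  proof -
    have "strict_mono_on {1..n} t" using that by (simp add: increasing_seqs_def)
    then have "sorted_wrt (<) (map t [1..<Suc n])"
      unfolding sorted_wrt_map
      by (intro sorted_wrt_mono_rel[OF _ sorted_wrt_upt]) (auto simp: strict_mono_on_def)
    then show ?thesis using strict_sorted_iff by blast
  qed
  have "set (map r [1..<Suc n]) = set (map s [1..<Suc n])"
    using assms(3) by (simp add: atLeastLessThanSuc_atLeastAtMost del: upt_Suc)
  then have "map r [1..<Suc n] = map s [1..<Suc n]"
    using *[OF assms(1)] *[OF assms(2)] sorted_distinct_set_unique by blast
  then have "r i = s i" if "i \<in> {1..n}" for i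
    using that by (simp del: upt_Suc)
  with assms(1,2) show ?thesis
    unfolding increasing_seqs_def by (intro PiE_ext[of r "{1..n}" "\<lambda>_. {0<..}" s]) auto
qed

lemma increasing_seqs_surj:
  assumes "finite A" "A \<subseteq> {0<..}"
  obtains r where "r \<in> increasing_seqs (card A)" "r ` {1..card A} = A"
proof -
  obtain q where q: "bij_betw q {..<card A} A" "strict_mono_on {..<card A} q"
    using ex_bij_betw_strict_mono_card[OF assms(1)] by blast
  \<comment> \<open>\<open>q\<close> counts from 0 and the sequences from 1, hence the shift;
    \<open>restrict\<close> supplies the value \<open>undefined\<close> demanded by the extensional
    function space.\<close>
  define r where "r = restrict (\<lambda>i. q (i - 1)) {1..card A}"
  have "(\<lambda>i. i - 1) ` {1..card A} = {..<card A}"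
    by (force simp: image_iff intro: bexI[of _ "Suc _"])
  moreover have "r ` {1..card A} = q ` (\<lambda>i. i - 1) ` {1..card A}"
    by (auto simp: r_def image_image)
  ultimately have im: "r ` {1..card A} = A"
    using q(1) by (simp add: bij_betw_def)
  moreover have "strict_mono_on {1..card A} r"
    by (auto simp: r_def intro!: strict_mono_onI strict_mono_onD[OF q(2)])
  ultimately have "r \<in> increasing_seqs (card A)"
    using assms(2) by (auto simp: increasing_seqs_def r_def)
  with im show thesis using that by blast
qed

lemma increasing_seqs_inj_on: "r \<in> increasing_seqs n \<Longrightarrow> inj_on r {1..n}"
  by (auto simp: increasing_seqs_def intro: strict_mono_on_imp_inj_on)

lemma increasing_seqs_less:
  "r \<in> increasing_seqs n \<Longrightarrow> (i, j) \<in> index_pairs n \<Longrightarrow> 0 < r i \<and> r i < r j"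
  by (auto simp: increasing_seqs_def index_pairs_def dest: PiE_mem intro: strict_mono_onD)

section \<open>Graphs read through an indexing of their vertices\<close>

text \<open>Both vertex sets are indexed by \<open>I\<close>, so \<open>c\<close> after the inverse
  of \<open>b\<close> is the isomorphism. In this form edges can be compared index by index, without
  mentioning the inverse.\<close>

lemma graph_isoI_parametrized:
  assumes "bij_betw b I (verts G)" "bij_betw c I (verts K)"
    and "\<And>i j. i \<in> I \<Longrightarrow> j \<in> I \<Longrightarrow> {b i, b j} \<in> edges G \<longleftrightarrow> {c i, c j} \<in> edges K"
  shows "graph_iso G K"
  unfolding graph_iso_def
proof (intro exI[of _ "c \<circ> inv_into I b"] conjI ballI)
  show "bij_betw (c \<circ> inv_into I b) (verts G) (verts K)"
    using assms(1,2) by (intro bij_betw_trans[OF bij_betw_inv_into])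
next
  fix u v assume "u \<in> verts G" "v \<in> verts G"
  then have "inv_into I b u \<in> I" "inv_into I b v \<in> I"
    "b (inv_into I b u) = u" "b (inv_into I b v) = v"
    using assms(1) by (auto simp: bij_betw_def inv_into_into f_inv_into_f)
  then show "({u, v} \<in> edges G) =
      ({(c \<circ> inv_into I b) u, (c \<circ> inv_into I b) v} \<in> edges K)"
    using assms(3) by fastforce
qed

lemma finite_index_pairs: "finite (index_pairs k)"
  by (rule finite_subset[of _ "{1..k} \<times> {1..k}"]) (auto simp: index_pairs_def)

lemma index_pairs_cases:
  assumes "i \<in> {1..n}" "j \<in> {1..n}" "i \<noteq> j"
  shows "(i, j) \<in> index_pairs n \<or> (j, i) \<in> index_pairs n"
  using assms by (auto simp: index_pairs_def)

lemma adj_eq_1_iff: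
  "adj G l (i, j) = 1 \<longleftrightarrow> 0 < i \<and> i < j \<and> j \<le> card (verts G) \<and> {l i, l j} \<in> edges G"
  by (simp add: adj_def)

lemma simple_graph_no_loop: "simple_graph G \<Longrightarrow> {u, u} \<notin> edges G"
  by (auto simp: simple_graph_def)

text \<open>The two endpoints of an edge are distinct, and swapping them if necessary makes their
  indices increasing; so ordered index pairs reach every edge.\<close>

lemma simple_graph_edges_parametrized:
  assumes "simple_graph K" "bij_betw c {1..n} (verts K)"
  shows "edges K = {{c i, c j} |i j. (i, j) \<in> index_pairs n \<and> {c i, c j} \<in> edges K}" (is "_ = ?E")
proof
  show "edges K \<subseteq> ?E"
  proof
    fix e assume e: "e \<in> edges K"
    then have "e \<subseteq> verts K" "card e = 2" using assms(1) by (auto simp: simple_graph_def)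
    then obtain u v where uv: "e = {u, v}" "u \<noteq> v" "u \<in> verts K" "v \<in> verts K"
      by (auto simp: card_2_iff)
    then obtain i j where ij: "i \<in> {1..n}" "j \<in> {1..n}" "u = c i" "v = c j"
      using assms(2) unfolding bij_betw_def by blast
    then have "i \<noteq> j" using uv by auto
    have eq: "e = {c i, c j}" "e = {c j, c i}" using ij uv by auto
    from index_pairs_cases[OF ij(1,2) \<open>i \<noteq> j\<close>] show "e \<in> ?E"
    proof
      assume "(i, j) \<in> index_pairs n"
      then show ?thesis using e eq(1) by auto
    next
      assume "(j, i) \<in> index_pairs n"
      then show ?thesis using e eq(2) by auto
    qed
  qed
qed auto

section \<open>The monomial of a pair \<open>(r, \<sigma>)\<close>\<close>

locale enumerated_graph =
  fixes G :: "'v graph" and l :: "nat \<Rightarrow> 'v" and R :: "(nat \<Rightarrow> nat) set"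
  assumes simple: "simple_graph G"
    and no_isolated: "no_isolated_vertex G"
    and lab: "labeling G l"
    and reps: "representatives (card (verts G)) (adj G l) R"
begin

abbreviation "n \<equiv> card (verts G)"

lemma label_bij: "bij_betw l {1..n} (verts G)"
  using lab by (simp add: labeling_def)

lemma R_permutes: "\<sigma> \<in> R \<Longrightarrow> \<sigma> permutes {1..n}"
  using reps by (auto simp: representatives_def)

lemma label_perm_bij: "\<sigma> permutes {1..n} \<Longrightarrow> bij_betw (\<lambda>i. l (\<sigma> i)) {1..n} (verts G)"
  using bij_betw_trans[OF permutes_imp_bij label_bij] by (simp add: comp_def)

text \<open>\<open>adj\<close> records an edge only at its increasing pair. The minimum and maximum
  in \<open>perm_act\<close> select that pair, so the order of \<open>\<sigma> i\<close> and
  \<open>\<sigma> j\<close> disappears.\<close>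

lemma adj_perm_act:
  assumes "\<sigma> permutes {1..n}" "(i, j) \<in> index_pairs n"
  shows "adj G l (perm_act \<sigma> (i, j)) = of_bool ({l (\<sigma> i), l (\<sigma> j)} \<in> edges G)"
proof -
  have ij: "i \<in> {1..n}" "j \<in> {1..n}" "i \<noteq> j" using assms(2) by (auto simp: index_pairs_def)
  then have "\<sigma> i \<in> {1..n}" "\<sigma> j \<in> {1..n}" "\<sigma> i \<noteq> \<sigma> j"
    using assms(1) by (auto simp: permutes_in_image permutes_inj inj_eq simp del: atLeastAtMost_iff)
  then show ?thesis
    by (cases "\<sigma> i < \<sigma> j") (auto simp: adj_def perm_act_def insert_commute)
qed

text \<open>The index pairs of the variables that occur in the monomial of
  \<open>(r, \<sigma>)\<close>.\<close>

definition occupied :: "(nat \<Rightarrow> nat) \<Rightarrow> (nat \<Rightarrow> nat) \<Rightarrow> (nat \<times> nat) set" where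
  "occupied r \<sigma> = {(r i, r j) |i j. (i, j) \<in> index_pairs n \<and> {l (\<sigma> i), l (\<sigma> j)} \<in> edges G}"

text \<open>Since \<open>r\<close> is injective, different index pairs contribute different
  variables, so exponents never accumulate and the monomial is squarefree.\<close>

lemma lookup_M_term:
  assumes r: "r \<in> increasing_seqs n" and \<sigma>: "\<sigma> permutes {1..n}"
  shows "Poly_Mapping.lookup (M_term G l (r, \<sigma>)) q = of_bool (q \<in> occupied r \<sigma>)"
proof -
  let ?e = "\<lambda>(i, j). {l (\<sigma> i), l (\<sigma> j)} \<in> edges G" and ?r = "\<lambda>(i, j). (r i, r j)"
  let ?S = "{p \<in> index_pairs n. ?e p}"
  have "inj_on ?r (index_pairs n)"
    using map_prod_inj_on[OF increasing_seqs_inj_on[OF r] increasing_seqs_inj_on[OF r]]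
    unfolding map_prod_def by (rule inj_on_subset) (auto simp: index_pairs_def)
  then have inj: "inj_on ?r ?S"
    by (rule inj_on_subset) auto
  have "Poly_Mapping.lookup (M_term G l (r, \<sigma>)) q =
      (\<Sum>p\<in>index_pairs n. of_bool (?r p = q \<and> ?e p))"
    unfolding M_term_def prod.case lookup_sum
    using adj_perm_act[OF \<sigma>, where 'a = nat] by (intro sum.cong) (auto simp: lookup_single when_def)
  also have "\<dots> = card (?S \<inter> ?r -` {q})"
    using finite_index_pairs
    by (auto simp: of_bool_def sum.If_cases intro!: arg_cong[of _ _ card])
  also have "\<dots> = of_bool (q \<in> ?r ` ?S)"
  proof (cases "q \<in> ?r ` ?S")
    case True
    then obtain p where p: "p \<in> ?S" "q = ?r p" by (rule imageE)
    have "?S \<inter> ?r -` {q} = {p}"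
      using p(1) inj_onD[OF inj _ _ p(1)] unfolding p(2) by blast
    then show ?thesis using True by simp
  next
    case False
    then have "?S \<inter> ?r -` {q} = {}" by blast
    then show ?thesis using False by simp
  qed
  also have "?r ` ?S = occupied r \<sigma>"
    by (force simp: occupied_def)
  finally show ?thesis .
qed

lemma keys_M_term:
  assumes "r \<in> increasing_seqs n" "\<sigma> permutes {1..n}"
  shows "Poly_Mapping.keys (M_term G l (r, \<sigma>)) = occupied r \<sigma>"
  by (auto simp: in_keys_iff lookup_M_term[OF assms])

text \<open>All exponents on the support are 1 and all substituted values are 0 or 1, so a single
  zero factor decides the product.\<close>

lemma monomial_value_M_term:
  assumes "r \<in> increasing_seqs n" "\<sigma> permutes {1..n}"
  shows "monomial_value (adj H h) (M_term G l (r, \<sigma>)) =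
    of_bool (\<forall>p\<in>occupied r \<sigma>. adj H h p = (1::int))"
proof -
  have "finite (occupied r \<sigma>)"
    using keys_M_term[OF assms] by (metis finite_keys)
  moreover have "adj H h p = 0 \<or> adj H h p = (1::int)" for p
    by (cases p) (auto simp: adj_def)
  moreover have "monomial_value (adj H h) (M_term G l (r, \<sigma>)) = (\<Prod>p\<in>occupied r \<sigma>. adj H h p)"
    unfolding monomial_value_def keys_M_term[OF assms]
    by (intro prod.cong) (simp_all add: lookup_M_term[OF assms])
  ultimately show ?thesis
    by (cases "\<forall>p\<in>occupied r \<sigma>. adj H h p = (1::int)") (auto intro: prod_zero)
qed

section \<open>Recovering \<open>(r, \<sigma>)\<close> from its variables\<close>

lemma occupied_edge:
  assumes "\<sigma> permutes {1..n}" "i \<in> {1..n}" "j \<in> {1..n}" "{l (\<sigma> i), l (\<sigma> j)} \<in> edges G"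
  shows "(r i, r j) \<in> occupied r \<sigma> \<or> (r j, r i) \<in> occupied r \<sigma>"
proof -
  have "i \<noteq> j" using assms(4) simple_graph_no_loop[OF simple] by auto
  from index_pairs_cases[OF assms(2,3) this] show ?thesis
    using assms(4) insert_commute[of "l (\<sigma> i)" "l (\<sigma> j)" "{}"] unfolding occupied_def
    by fastforce
qed

text \<open>This is where the absence of isolated vertices enters: the vertex at position
  \<open>i\<close> has a neighbour at some position \<open>j\<close>, so \<open>r i\<close> is a
  coordinate of an occupied pair.\<close>

lemma occupied_range:
  assumes "\<sigma> permutes {1..n}"
  shows "fst ` occupied r \<sigma> \<union> snd ` occupied r \<sigma> = r ` {1..n}"
proof
  show "fst ` occupied r \<sigma> \<union> snd ` occupied r \<sigma> \<subseteq> r ` {1..n}"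
    by (auto simp: occupied_def index_pairs_def)
  show "r ` {1..n} \<subseteq> fst ` occupied r \<sigma> \<union> snd ` occupied r \<sigma>"
  proof
    fix k assume "k \<in> r ` {1..n}"
    then obtain i where i: "i \<in> {1..n}" "k = r i" by blast
    have im: "(\<lambda>i. l (\<sigma> i)) ` {1..n} = verts G"
      using label_perm_bij[OF assms] by (simp add: bij_betw_def)
    then have "l (\<sigma> i) \<in> verts G" using i(1) by blast
    then obtain w where w: "w \<in> verts G" "{l (\<sigma> i), w} \<in> edges G"
      using no_isolated by (auto simp: no_isolated_vertex_def)
    then obtain j where "j \<in> {1..n}" "w = l (\<sigma> j)" using im by blast
    then show "k \<in> fst ` occupied r \<sigma> \<union> snd ` occupied r \<sigma>"
      using occupied_edge[OF assms i(1), of j r] w(2) i(2) by force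
  qed
qed

lemma occupied_iff:
  assumes "r \<in> increasing_seqs n" "(i, j) \<in> index_pairs n"
  shows "(r i, r j) \<in> occupied r \<sigma> \<longleftrightarrow> {l (\<sigma> i), l (\<sigma> j)} \<in> edges G"
proof -
  have "i = i'" "j = j'" if "(i', j') \<in> index_pairs n" "r i = r i'" "r j = r j'" for i' j'
    using that assms(2)
    by (auto intro!: inj_onD[OF increasing_seqs_inj_on[OF assms(1)]] simp: index_pairs_def)
  then show ?thesis using assms(2) unfolding occupied_def by blast
qed

lemma occupied_inj:
  assumes "r \<in> increasing_seqs n" "\<sigma> \<in> R" "s \<in> increasing_seqs n" "\<tau> \<in> R"
    and eq: "occupied r \<sigma> = occupied s \<tau>"
  shows "r = s \<and> \<sigma> = \<tau>"
proof -
  have "r ` {1..n} = s ` {1..n}"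
    using occupied_range[OF R_permutes] assms(2,4) eq by metis
  then have rs: "r = s" using increasing_seqs_inj assms(1,3) by blast
  \<comment> \<open>With \<open>r = s\<close>, whether \<open>(r i, r j)\<close> is occupied reads
    off the entry at \<open>(i, j)\<close>, so the two families agree; \<open>R\<close> holds only
    one permutation per family.\<close>
  have "permuted_family n (adj G l) \<sigma> = permuted_family n (adj G l) \<tau>"
    unfolding permuted_family_def
  proof (rule restrict_ext)
    fix p assume p: "p \<in> index_pairs n"
    obtain i j where ij: "p = (i, j)" by force
    show "adj G l (perm_act \<sigma> p) = (adj G l (perm_act \<tau> p) :: nat)"
      using p occupied_iff[OF assms(1), of i j \<sigma>] occupied_iff[OF assms(1), of i j \<tau>] eq rs
        adj_perm_act[OF R_permutes[OF assms(2)], of i j, where 'a = nat]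
        adj_perm_act[OF R_permutes[OF assms(4)], of i j, where 'a = nat]
      by (simp add: ij)
  qed
  moreover have "inj_on (permuted_family n (adj G l)) R"
    using reps by (simp add: representatives_def)
  ultimately show ?thesis using rs assms(2,4) by (auto simp: inj_on_def)
qed

lemma M_term_inj: "inj_on (M_term G l) (M_index G R)"
proof (rule inj_onI)
  fix x y assume x: "x \<in> M_index G R" and y: "y \<in> M_index G R"
    and eq: "M_term G l x = M_term G l y"
  obtain r \<sigma> s \<tau> where xy: "x = (r, \<sigma>)" "y = (s, \<tau>)" by force
  have m: "r \<in> increasing_seqs n" "\<sigma> \<in> R" "s \<in> increasing_seqs n" "\<tau> \<in> R"
    using x y by (auto simp: xy M_index_def)
  have "occupied r \<sigma> = occupied s \<tau>"
    using eq keys_M_term[OF m(1) R_permutes[OF m(2)]] keys_M_term[OF m(3) R_permutes[OF m(4)]]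
    by (simp add: xy)
  from occupied_inj[OF m this] show "x = y" by (simp add: xy)
qed

text \<open>Injectivity leaves at most one index above each monomial. Stated as two shapes, this
  yields both the finiteness needed for \<open>formal_summable\<close> and the cardinality 0 or 1 of
  the coefficient.\<close>

lemma fibre_M_term:
  "{i \<in> M_index G R. M_term G l i = m} = {} \<or> (\<exists>i. {i \<in> M_index G R. M_term G l i = m} = {i})"
proof (cases "m \<in> M_term G l ` M_index G R")
  case True
  then obtain i where i: "i \<in> M_index G R" "m = M_term G l i" by (rule imageE)
  then have "{i \<in> M_index G R. M_term G l i = m} = {i}"
    using inj_onD[OF M_term_inj _ _ i(1)] by auto
  then show ?thesis by blast
qed auto

lemma formal_summable_M: "formal_summable (M_index G R) (M_term G l)"
  unfolding formal_summable_def
proof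
  fix m show "finite {i \<in> M_index G R. M_term G l i = m}"
    using fibre_M_term[of m] by (elim disjE exE) (simp_all del: Collect_empty_eq)
qed

lemma M_coeff: "M G l R m = of_bool (m \<in> M_term G l ` M_index G R)"
proof -
  let ?F = "{i \<in> M_index G R. M_term G l i = m}"
  have "m \<in> M_term G l ` M_index G R \<longleftrightarrow> ?F \<noteq> {}" by blast
  moreover have "card ?F = of_bool (?F \<noteq> {})"
    using fibre_M_term[of m] by (elim disjE exE) (simp_all del: Collect_empty_eq)
  ultimately show ?thesis unfolding M_def formal_sum_def by simp
qed

section \<open>Evaluation at a graph \<open>H\<close>\<close>

text \<open>The indices whose monomials take the value 1 at \<open>H\<close>: every occupied
  variable names an edge of \<open>H\<close> in the labels of \<open>h\<close>.\<close>

definition placements :: "'w graph \<Rightarrow> (nat \<Rightarrow> 'w) \<Rightarrow> ((nat \<Rightarrow> nat) \<times> (nat \<Rightarrow> nat)) set" where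
  "placements H h =
    {(r, \<sigma>) \<in> M_index G R. \<forall>p\<in>occupied r \<sigma>. adj H h p = (1::int)}"

text \<open>Substitution sums over monomials, not over indices. Coefficients are 0 or 1, and so are
  the values of the monomials that occur, hence a nonzero term can only be 1.\<close>

lemma M_nonzero_terms:
  "{m. M G l R m * monomial_value (adj H h) m \<noteq> 0} = M_term G l ` placements H h"
  "m \<in> M_term G l ` placements H h \<Longrightarrow> M G l R m * monomial_value (adj H h) m = 1"
proof -
  have *: "monomial_value (adj H h) (M_term G l x) = of_bool (x \<in> placements H h)"
    if "x \<in> M_index G R" for x
  proof -
    obtain r \<sigma> where x: "x = (r, \<sigma>)" by force
    then have "r \<in> increasing_seqs n" "\<sigma> \<in> R" using that by (auto simp: M_index_def)
    then show ?thesis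
      using monomial_value_M_term[OF _ R_permutes, of r \<sigma> H h] that
      by (simp add: placements_def x)
  qed
  have sub: "placements H h \<subseteq> M_index G R" by (auto simp: placements_def)
  show "{m. M G l R m * monomial_value (adj H h) m \<noteq> 0} = M_term G l ` placements H h"
    using * sub by (auto simp: M_coeff)
  show "M G l R m * monomial_value (adj H h) m = 1" if "m \<in> M_term G l ` placements H h"
  proof -
    from that obtain x where "x \<in> placements H h" "m = M_term G l x" by (rule imageE)
    then show ?thesis using *[of x] sub by (auto simp: M_coeff)
  qed
qed

section \<open>The bijection between placements and copies of \<open>G\<close> in
  \<open>H\<close>\<close>

text \<open>Reads a placement as a subgraph of the host: labels become vertices through
  \<open>h\<close>, and occupied variables become edges.\<close>

definition placed_graph :: "(nat \<Rightarrow> 'w) \<Rightarrow> (nat \<Rightarrow> nat) \<times> (nat \<Rightarrow> nat) \<Rightarrow> 'w graph" where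
  "placed_graph h = (\<lambda>(r, \<sigma>). (h ` r ` {1..n}, (\<lambda>(i, j). {h i, h j}) ` occupied r \<sigma>))"

text \<open>Each \<open>r i\<close> is a coordinate of an occupied pair by
  \<open>occupied_range\<close>, and \<open>adj H h\<close> vanishes beyond the labels of
  \<open>H\<close>. The bound keeps \<open>h (r i)\<close> inside \<open>H\<close>, since
  \<open>h\<close> is arbitrary elsewhere.\<close>

lemma placements_range:
  assumes "(r, \<sigma>) \<in> placements H h"
  shows "r ` {1..n} \<subseteq> {1..card (verts H)}"
proof -
  have "\<sigma> permutes {1..n}" using assms R_permutes by (auto simp: placements_def M_index_def)
  moreover have "fst p \<in> {1..card (verts H)}" "snd p \<in> {1..card (verts H)}"
    if "p \<in> occupied r \<sigma>" for p
    using that assms by (cases p; auto simp: placements_def adj_eq_1_iff)+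
  ultimately show ?thesis
    unfolding occupied_range[OF \<open>\<sigma> permutes {1..n}\<close>, of r, symmetric] by fast
qed

context
  fixes H :: "'w graph" and h :: "nat \<Rightarrow> 'w"
  assumes simpleH: "simple_graph H" and labH: "labeling H h"
begin

lemma host_bij: "bij_betw h {1..card (verts H)} (verts H)"
  using labH by (simp add: labeling_def)

text \<open>Position \<open>i\<close> stands for \<open>l (\<sigma> i)\<close> in \<open>G\<close>
  and for \<open>h (r i)\<close> in the placed graph; with both vertex sets indexed by positions,
  edges correspond by construction.\<close>

lemma placed_graph_in_copies:
  assumes "x \<in> placements H h"
  shows "placed_graph h x \<in> copies G H"
proof -
  obtain r \<sigma> where x: "x = (r, \<sigma>)" by force
  let ?K = "placed_graph h x" and ?c = "\<lambda>i. h (r i)"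
  have r: "r \<in> increasing_seqs n" and \<sigma>: "\<sigma> permutes {1..n}"
    using assms R_permutes by (auto simp: x placements_def M_index_def)
  have range: "r ` {1..n} \<subseteq> {1..card (verts H)}"
    using placements_range assms x by blast
  have inj: "inj_on ?c {1..n}"
    using comp_inj_on[OF increasing_seqs_inj_on[OF r] inj_on_subset[OF bij_betw_imp_inj_on[OF host_bij] range]]
    by (simp add: comp_def)
  have V: "verts ?K = ?c ` {1..n}"
    by (auto simp: x placed_graph_def)
  have E: "edges ?K = {{?c i, ?c j} |i j. (i, j) \<in> index_pairs n \<and> {l (\<sigma> i), l (\<sigma> j)} \<in> edges G}"
    by (force simp: x placed_graph_def occupied_def)
  have EH: "edges ?K \<subseteq> edges H"
    using assms by (auto simp: x placed_graph_def placements_def adj_def)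
  have VH: "verts ?K \<subseteq> verts H"
    using range host_bij by (auto simp: V bij_betw_def)
  have "simple_graph ?K"
    using EH simpleH unfolding simple_graph_def
    by (auto simp: V) (auto simp: E index_pairs_def)
  moreover have "graph_iso G ?K"
  proof (rule graph_isoI_parametrized[OF label_perm_bij[OF \<sigma>]])
    show "bij_betw ?c {1..n} (verts ?K)" using inj by (simp add: V bij_betw_def)
  next
    fix i j assume ij: "i \<in> {1..n}" "j \<in> {1..n}"
    show "{l (\<sigma> i), l (\<sigma> j)} \<in> edges G \<longleftrightarrow> {?c i, ?c j} \<in> edges ?K"
    proof
      assume e: "{l (\<sigma> i), l (\<sigma> j)} \<in> edges G"
      then have "i \<noteq> j" using simple_graph_no_loop[OF simple] by auto
      moreover have "{?c i, ?c j} = {?c j, ?c i}" "{l (\<sigma> j), l (\<sigma> i)} \<in> edges G"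
        using e by (auto simp: insert_commute)
      ultimately show "{?c i, ?c j} \<in> edges ?K"
        unfolding E using index_pairs_cases[OF ij] e by blast
    next
      assume "{?c i, ?c j} \<in> edges ?K"
      then obtain i' j' where *: "(i', j') \<in> index_pairs n" "{l (\<sigma> i'), l (\<sigma> j')} \<in> edges G"
        "{?c i, ?c j} = {?c i', ?c j'}"
        unfolding E by blast
      then have "i' \<in> {1..n}" "j' \<in> {1..n}" by (auto simp: index_pairs_def)
      \<comment> \<open>\<open>?c\<close> is injective on positions, so the edge comes from
        \<open>i\<close> and \<open>j\<close> themselves, possibly swapped.\<close>
      with *(3) ij have "{i, j} = {i', j'}"
        using inj_on_image_eq_iff[OF inj, of "{i, j}" "{i', j'}"] by simp
      then show "{l (\<sigma> i), l (\<sigma> j)} \<in> edges G"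
        using *(2) by (auto simp: doubleton_eq_iff insert_commute)
    qed
  qed
  ultimately show ?thesis using EH VH by (simp add: copies_def)
qed

text \<open>An occupied pair is increasing, so it can be read back from the edge it names,
  \<open>h\<close> being injective on labels. The edge set thus determines the occupied set, and
  \<open>occupied_inj\<close> applies.\<close>

lemma placed_graph_inj: "inj_on (placed_graph h) (placements H h)"
proof (rule inj_onI)
  fix x y assume x: "x \<in> placements H h" and y: "y \<in> placements H h"
    and eq: "placed_graph h x = placed_graph h y"
  obtain r \<sigma> s \<tau> where xy: "x = (r, \<sigma>)" "y = (s, \<tau>)" by force
  have m: "r \<in> increasing_seqs n" "\<sigma> \<in> R" "s \<in> increasing_seqs n" "\<tau> \<in> R"
    using x y by (auto simp: xy placements_def M_index_def)
  let ?P = "{(i, j). i \<in> {1..card (verts H)} \<and> j \<in> {1..card (verts H)} \<and> i < j}"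
  have inj: "inj_on (\<lambda>(i, j). {h i, h j}) ?P"
  proof -
    have "inj_on h {1..card (verts H)}" using host_bij by (simp add: bij_betw_def)
    then have "{i, j} = {i', j'}" if "(i, j) \<in> ?P" "(i', j') \<in> ?P" "{h i, h j} = {h i', h j'}"
      for i j i' j'
      using that inj_on_image_eq_iff[of h _ "{i, j}" "{i', j'}"] by simp
    then show ?thesis
      by (intro inj_onI) (fastforce simp: doubleton_eq_iff)
  qed
  have sub: "occupied r \<sigma> \<subseteq> ?P" "occupied s \<tau> \<subseteq> ?P"
    using x y by (fastforce simp: xy placements_def adj_eq_1_iff)+
  have "(\<lambda>(i, j). {h i, h j}) ` occupied r \<sigma> = (\<lambda>(i, j). {h i, h j}) ` occupied s \<tau>"
    using eq by (simp add: xy placed_graph_def)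
  then have "occupied r \<sigma> = occupied s \<tau>"
    using inj_on_image_eq_iff[OF inj sub] by (rule iffD1[rotated])
  from occupied_inj[OF m this] show "x = y" by (simp add: xy)
qed

text \<open>The vertex set of \<open>K\<close> dictates \<open>r\<close>, the isomorphism then gives
  a permutation, and its representative in \<open>R\<close> produces the same edges.\<close>

lemma copies_subset_placed_graph:
  assumes K: "K \<in> copies G H"
  shows "K \<in> placed_graph h ` placements H h"
proof -
  have sK: "simple_graph K" and VH: "verts K \<subseteq> verts H" and EH: "edges K \<subseteq> edges H"
    using K by (auto simp: copies_def)
  obtain f where f: "bij_betw f (verts G) (verts K)"
    and fE: "\<And>u v. u \<in> verts G \<Longrightarrow> v \<in> verts G \<Longrightarrow> {u, v} \<in> edges G \<longleftrightarrow> {f u, f v} \<in> edges K"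
    using K by (auto simp: copies_def graph_iso_def)
  \<comment> \<open>The labels in \<open>H\<close> of the vertices of \<open>K\<close>;
    \<open>r\<close> will enumerate them increasingly.\<close>
  define A where "A = {i \<in> {1..card (verts H)}. h i \<in> verts K}"
  have hA: "bij_betw h A (verts K)"
  proof -
    have "h ` {1..card (verts H)} = verts H" using host_bij by (simp add: bij_betw_def)
    moreover have "h ` A = h ` {1..card (verts H)} \<inter> verts K" by (auto simp: A_def)
    ultimately have "h ` A = verts K" using VH by auto
    then show ?thesis
      by (intro bij_betw_subset[OF host_bij]) (auto simp: A_def)
  qed
  have cA: "card A = n"
    using bij_betw_same_card[OF hA] bij_betw_same_card[OF f] by simp
  obtain r where r: "r \<in> increasing_seqs n" "r ` {1..n} = A"
    using increasing_seqs_surj[of A] cA by (force simp: A_def)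
  have rA: "bij_betw r {1..n} A"
    using r increasing_seqs_inj_on by (simp add: bij_betw_def)
  define c where "c = (\<lambda>i. h (r i))"
  have c: "bij_betw c {1..n} (verts K)"
    using bij_betw_trans[OF rA hA] by (simp add: c_def comp_def)
  \<comment> \<open>Chosen so that \<open>f (l (\<sigma>0 i)) = c i\<close> on
    \<open>{1..n}\<close>; it is the identity elsewhere, as \<open>permutes\<close>
    requires.\<close>
  define \<sigma>0 where "\<sigma>0 = (\<lambda>i. if i \<in> {1..n}
    then inv_into {1..n} l (inv_into (verts G) f (c i)) else i)"
  have "bij_betw (\<lambda>i. inv_into {1..n} l (inv_into (verts G) f (c i))) {1..n} {1..n}"
    using bij_betw_trans[OF bij_betw_trans[OF c bij_betw_inv_into[OF f]] bij_betw_inv_into[OF label_bij]]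
    by (simp add: comp_def)
  then have "bij_betw \<sigma>0 {1..n} {1..n}"
    by (rule iffD1[OF bij_betw_cong, rotated]) (simp add: \<sigma>0_def)
  then have \<sigma>0: "\<sigma>0 permutes {1..n}"
    by (rule bij_imp_permutes) (auto simp: \<sigma>0_def)
  have l\<sigma>0: "l (\<sigma>0 i) \<in> verts G \<and> f (l (\<sigma>0 i)) = c i" if i: "i \<in> {1..n}" for i
  proof -
    have "c i \<in> verts K" using c i by (rule bij_betw_apply)
    then have "inv_into (verts G) f (c i) \<in> verts G" "f (inv_into (verts G) f (c i)) = c i"
      using bij_betw_apply[OF bij_betw_inv_into[OF f]] bij_betw_inv_into_right[OF f] by auto
    then show ?thesis
      using i bij_betw_inv_into_right[OF label_bij] by (simp add: \<sigma>0_def)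
  qed
  \<comment> \<open>\<open>\<sigma>0\<close> need not lie in \<open>R\<close>. Passing to
    \<open>\<sigma>\<close> may break \<open>f (l (\<sigma> i)) = c i\<close>, but equal families
    mean equal edges at each pair of positions, and only these enter
    \<open>occupied\<close>.\<close>
  obtain \<sigma> where \<sigma>: "\<sigma> \<in> R" "permuted_family n (adj G l) \<sigma> = permuted_family n (adj G l) \<sigma>0"
  proof -
    have "permuted_family n (adj G l) \<sigma>0 \<in> permuted_family n (adj G l) ` R"
      using reps \<sigma>0 by (auto simp: representatives_def)
    then show thesis using that by (metis imageE)
  qed
  have key: "{l (\<sigma> i), l (\<sigma> j)} \<in> edges G \<longleftrightarrow> {c i, c j} \<in> edges K"
    if ij: "(i, j) \<in> index_pairs n" for i j
  proof -
    have i: "i \<in> {1..n}" and j: "j \<in> {1..n}" using ij by (auto simp: index_pairs_def)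
    have "adj G l (perm_act \<sigma> (i, j)) = (adj G l (perm_act \<sigma>0 (i, j)) :: nat)"
      using fun_cong[OF \<sigma>(2), of "(i, j)"] ij by (simp add: permuted_family_def)
    then have "{l (\<sigma> i), l (\<sigma> j)} \<in> edges G \<longleftrightarrow> {l (\<sigma>0 i), l (\<sigma>0 j)} \<in> edges G"
      using adj_perm_act[OF R_permutes[OF \<sigma>(1)] ij, where 'a = nat]
        adj_perm_act[OF \<sigma>0 ij, where 'a = nat] by (simp add: of_bool_eq_iff)
    then show ?thesis using fE[of "l (\<sigma>0 i)" "l (\<sigma>0 j)"] l\<sigma>0[OF i] l\<sigma>0[OF j] by simp
  qed
  have occ: "occupied r \<sigma> = {(r i, r j) |i j. (i, j) \<in> index_pairs n \<and> {c i, c j} \<in> edges K}"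
    using key by (auto simp: occupied_def)
  have "(r, \<sigma>) \<in> placements H h"
  proof -
    have "adj H h (r i, r j) = (1::int)" if "(i, j) \<in> index_pairs n" "{c i, c j} \<in> edges K" for i j
    proof -
      \<comment> \<open>\<open>adj\<close> also demands an upper bound on \<open>r j\<close>, which
        membership in \<open>A\<close> provides.\<close>
      have "j \<in> {1..n}" using that(1) by (simp add: index_pairs_def)
      then have "r j \<in> A" unfolding r(2)[symmetric] by (rule imageI)
      then show ?thesis
        using increasing_seqs_less[OF r(1) that(1)] that(2) EH by (auto simp: adj_def A_def c_def)
    qed
    then show ?thesis
      using r(1) \<sigma>(1) by (auto simp: placements_def M_index_def occ)
  qed
  moreover have "placed_graph h (r, \<sigma>) = K"
  proof (rule prod_eqI)
    show "verts (placed_graph h (r, \<sigma>)) = verts K"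
      using r(2) hA by (simp add: placed_graph_def bij_betw_def)
    have "edges (placed_graph h (r, \<sigma>)) =
        {{c i, c j} |i j. (i, j) \<in> index_pairs n \<and> {c i, c j} \<in> edges K}"
      by (force simp: placed_graph_def occ c_def)
    then show "edges (placed_graph h (r, \<sigma>)) = edges K"
      using simple_graph_edges_parametrized[OF sK c] by simp
  qed
  ultimately show ?thesis by (metis imageI)
qed

lemma placed_graph_bij: "bij_betw (placed_graph h) (placements H h) (copies G H)"
  unfolding bij_betw_def
  by (intro conjI placed_graph_inj subset_antisym image_subsetI subsetI
      placed_graph_in_copies copies_subset_placed_graph)

text \<open>Placements are in bijection with copies, and a finite graph has only finitely many
  subgraphs.\<close>

lemma substitutable_M: "substitutable (M G l R) (adj H h)"
  unfolding substitutable_def M_nonzero_terms(1)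
  using bij_betw_finite[OF placed_graph_bij] finite_copies[OF simpleH]
  by (intro finite_imageI) simp

text \<open>Every term on the support is 1, so the sum counts the monomials of placements;
  injectivity of \<open>M_term\<close> and the bijection turn this into the number of
  copies.\<close>

lemma substitute_M: "substitute (M G l R) (adj H h) = int (card (copies G H))"
proof -
  have "placements H h \<subseteq> M_index G R" by (auto simp: placements_def)
  then have "card (M_term G l ` placements H h) = card (placements H h)"
    by (intro card_image inj_on_subset[OF M_term_inj])
  also have "\<dots> = card (copies G H)" by (rule bij_betw_same_card[OF placed_graph_bij])
  finally show ?thesis
    unfolding substitute_def Sum_any.expand_set M_nonzero_terms(1)
    by (simp add: M_nonzero_terms(2))
qed

end

end

theorem theorem2p4:
  fixes G :: "'v graph" and l :: "nat \<Rightarrow> 'v" and R :: "(nat \<Rightarrow> nat) set"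
  assumes "simple_graph G"
    and "card (verts G) \<ge> 2"
    and "no_isolated_vertex G"
    and "labeling G l"
    and "representatives (card (verts G)) (adj G l) R"
  shows "formal_summable (M_index G R) (M_term G l) \<and>
    (\<forall>H :: 'w graph. simple_graph H \<longrightarrow>
      (\<forall>h. labeling H h \<longrightarrow> substitutable (M G l R) (adj H h)) \<and>
      (\<forall>h h'. labeling H h \<longrightarrow> labeling H h' \<longrightarrow>
         substitute (M G l R) (adj H h) = substitute (M G l R) (adj H h')) \<and>
      (\<forall>h. labeling H h \<longrightarrow>
         substitute (M G l R) (adj H h) = int (card (copies G H))))"
proof -
  interpret enumerated_graph G l R
    using assms by unfold_locales
  \<comment> \<open>The count in \<open>substitute_M\<close> does not mention the labeling, so
    rewriting both sides with it also settles independence of \<open>h\<close>.\<close>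
  show ?thesis
    by (intro conjI allI impI formal_summable_M substitutable_M) (simp_all only: substitute_M)
qed

end
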